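(* Let $\mathcal D$ be a set, let $\mathcal T$ be the $k$-linear span of the set of $\mathcal D$-decorated rooted trees, and let $(GL,\ast)$ be the Grossman--Larson algebra over $\mathcal D$. For any trees $t_1,\ldots,t_n$, the following identity holds in $GL$: $$ t_1\cdots t_n=\sum_{\{P_1,\ldots,P_k\}}(-1)^{n-k}\,t_{P_1}\ast\cdots\ast t_{P_k}, $$ where the left-hand side is the commutative (forest) product, and the sum runs over all set partitions $\{P_1,\ldots,P_k\}$ of $[n]=\{1,\ldots,n\}$ (any $k\ge1$), with the blocks indexed so that $\max(P_i)>j$ for all $j\in P_l$ whenever $l<i$ (i.e. $\max P_1<\max P_2<\cdots<\max P_k$). For a block $P_i=\{p^i_1<\cdots<p^i_h\}$ one sets $$ t_{P_i}:=\sum_{\sigma\in S_{h-1}} t_{p^i_{\sigma(1)}}\curvearrowleft\Big(t_{p^i_{\sigma(2)}}\curvearrowleft\big(\cdots\curvearrowleft(t_{p^i_{\sigma(h-1)}}\curvearrowleft t_{p^i_h})\cdots\big)\Big) $$ (for $h=1$, $t_{P_i}=t_{p^i_1}$).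
   Context: $k$ is a field of characteristic zero. A $\mathcal D$-decorated rooted tree is a finite connected, simply connected graph with a distinguished vertex (the root), each vertex carrying an element of $\mathcal D$. For trees $t,t'$, the grafting $t\curvearrowleft t'\in\mathcal T$ is the sum, over all vertices $v$ of $t$, of the tree obtained by adding an edge from $v$ to the root of $t'$ (the root of the result is the root of $t$); extended bilinearly. A forest is a commutative monomial $t_1\cdots t_n$ of trees; $GL$ is the symmetric algebra $S(\mathcal T)$ (the span of forests together with the empty forest $e$), whose commutative product is juxtaposition. Grafting is extended to an action of forests on trees recursively by $t\curvearrowleft e=t$ and, for trees $t,t_1,\ldots,t_n$, $t\curvearrowleft(t_1\cdots t_n)=(t\curvearrowleft(t_1\cdots t_{n-1}))\curvearrowleft t_n-\sum_{i=1}^{n-1}t\curvearrowleft(t_1\cdots t_{i-1}(t_i\curvearrowleft t_n)t_{i+1}\cdots t_{n-1})$, extended linearly. The Grossman--Larson product is the bilinear product with unit $e$ defined on forests by $(t_1\cdots t_n)\ast(t'_1\cdots t'_m)=\sum_f F_0\,(t_1\curvearrowleft F_1)\cdots(t_n\curvearrowleft F_n)$, the sum over all maps $f:\{1,\ldots,m\}\to\{0,\ldots,n\}$, with $F_i=\prod_{j\in f^{-1}(i)}t'_j$ (empty product $=e$). It is associative. *)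

theory Defs
  imports "HOL-Library.Multiset" "HOL-Library.Poly_Mapping" "HOL-Library.Disjoint_Sets"
    "HOL-Library.FuncSet" "HOL-Combinatorics.Permutations"
begin

text \<open>A D-decorated rooted tree (up to isomorphism): a root decoration and the
  multiset of subtrees hanging at the root. The decoration set D is the type 'd.\<close>
datatype 'd rtree = Node 'd "'d rtree multiset"

text \<open>Forests = commutative monomials of trees; the empty forest is the unit e.\<close>
type_synonym 'd forest = "'d rtree multiset"

text \<open>Linear combinations with coefficients in the field 'k: the span T of trees
  and GL = S(T), the span of forests.\<close>
type_synonym ('d, 'k) TT = "'d rtree \<Rightarrow>\<^sub>0 'k"
type_synonym ('d, 'k) GL = "'d forest \<Rightarrow>\<^sub>0 'k"

definition smult :: "'k::field \<Rightarrow> ('a \<Rightarrow>\<^sub>0 'k) \<Rightarrow> ('a \<Rightarrow>\<^sub>0 'k)" where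
  "smult c p = Poly_Mapping.map ((*) c) p"

definition lin :: "('a \<Rightarrow> ('b \<Rightarrow>\<^sub>0 'k::field)) \<Rightarrow> ('a \<Rightarrow>\<^sub>0 'k) \<Rightarrow> ('b \<Rightarrow>\<^sub>0 'k)" where
  "lin f p = (\<Sum>a\<in>Poly_Mapping.keys p. smult (Poly_Mapping.lookup p a) (f a))"

lemma lin_cong [fundef_cong]:
  "p = q \<Longrightarrow> (\<And>a. a \<in> Poly_Mapping.keys q \<Longrightarrow> f a = g a) \<Longrightarrow> lin f p = lin g q"
  unfolding lin_def by (auto intro: sum.cong)

declare image_mset_cong [fundef_cong]

abbreviation tree_vec :: "'d rtree \<Rightarrow> ('d, 'k::field) TT" where
  "tree_vec t \<equiv> Poly_Mapping.single t 1"

abbreviation forest_vec :: "'d forest \<Rightarrow> ('d, 'k::field) GL" where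
  "forest_vec F \<equiv> Poly_Mapping.single F 1"

definition T_to_GL :: "('d, 'k::field) TT \<Rightarrow> ('d, 'k) GL" where
  "T_to_GL p = lin (\<lambda>t. forest_vec {#t#}) p"

definition forest_mult :: "('d, 'k::field) GL \<Rightarrow> ('d, 'k) GL \<Rightarrow> ('d, 'k) GL" where
  "forest_mult p q = lin (\<lambda>F. lin (\<lambda>G. forest_vec (F + G)) q) p"

definition forest_mult_list :: "('d, 'k::field) GL list \<Rightarrow> ('d, 'k) GL" where
  "forest_mult_list ps = foldr forest_mult ps (forest_vec {#})"

text \<open>Grafting of a tree t' onto a tree t: sum over all vertices v of t of the
  tree obtained by adding an edge from v to the root of t'.  A vertex of
  Node d cs is either the root or a vertex of one of the subtrees in cs
  (counted with multiplicity).\<close>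
function graft_tree :: "'d rtree \<Rightarrow> 'd rtree \<Rightarrow> ('d, 'k::field) TT" where
  "graft_tree (Node d cs) t' =
     tree_vec (Node d (cs + {#t'#}))
     + sum_mset (image_mset (\<lambda>c. lin (\<lambda>c'. tree_vec (Node d (cs - {#c#} + {#c'#})))
                                       (graft_tree c t')) cs)"
  by pat_completeness auto
termination
proof (relation "measure (\<lambda>(t, t'). size t)")
  fix d and cs :: "'d rtree multiset" and t' c
  assume "c \<in># cs"
  then obtain cs' where "cs = add_mset c cs'" by (metis multi_member_split)
  then show "((c, t'), Node d cs, t') \<in> measure (\<lambda>(t, t'). size t)" by simp
qed auto

definition graft :: "('d, 'k::field) TT \<Rightarrow> ('d, 'k) TT \<Rightarrow> ('d, 'k) TT" where
  "graft p q = lin (\<lambda>t. lin (\<lambda>t'. graft_tree t t') q) p"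

text \<open>Action of a forest t_1 \<cdots> t_n (given as a list) on a tree t, by the
  recursion of the paper.  graft_rev t ys works with ys = rev [t_1,..,t_n], so
  that the head of ys is t_n; the inner forests with one factor replaced by a
  linear combination of trees are handled by linearity.\<close>
function graft_rev :: "'d rtree \<Rightarrow> 'd rtree list \<Rightarrow> ('d, 'k::field) TT" where
  "graft_rev t [] = tree_vec t"
| "graft_rev t (y # ys) =
     lin (\<lambda>s. graft_tree s y) (graft_rev t ys)
     - (\<Sum>i<length ys. lin (\<lambda>s. graft_rev t (ys[i := s])) (graft_tree (ys ! i) y))"
  by pat_completeness auto
termination
  by (relation "measure (\<lambda>(t, ys). length ys)") auto

definition graft_forest_list :: "'d rtree \<Rightarrow> 'd rtree list \<Rightarrow> ('d, 'k::field) TT" where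
  "graft_forest_list t xs = graft_rev t (rev xs)"

text \<open>t \<curvearrowleft> F for a forest F (a commutative monomial): evaluate the recursion
  on any enumeration of its factors.\<close>
definition graft_forest :: "'d rtree \<Rightarrow> 'd forest \<Rightarrow> ('d, 'k::field) TT" where
  "graft_forest t F = graft_forest_list t (SOME xs. mset xs = F)"

text \<open>For forests t_1\<cdots>t_n and t'_1\<cdots>t'_m (as lists xs, ys): sum over all
  maps f : {1..m} \<rightarrow> {0..n}; here indices of ys are 0..m-1 and value i \<ge> 1
  refers to xs ! (i - 1). F_i is the product of the t'_j with f j = i.\<close>
definition GL_block :: "'d rtree list \<Rightarrow> (nat \<Rightarrow> nat) \<Rightarrow> nat \<Rightarrow> 'd forest" where
  "GL_block ys f i = mset [ys ! j. j \<leftarrow> [0..<length ys], f j = i]"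

definition GL_forest_list :: "'d rtree list \<Rightarrow> 'd rtree list \<Rightarrow> ('d, 'k::field) GL" where
  "GL_forest_list xs ys =
     (\<Sum>f \<in> {..<length ys} \<rightarrow>\<^sub>E {..length xs}.
        forest_mult (forest_vec (GL_block ys f 0))
          (forest_mult_list
             (map (\<lambda>i. T_to_GL (graft_forest (xs ! (i - 1)) (GL_block ys f i)))
                  [1..<length xs + 1])))"

definition GL_forest :: "'d forest \<Rightarrow> 'd forest \<Rightarrow> ('d, 'k::field) GL" where
  "GL_forest F G = GL_forest_list (SOME xs. mset xs = F) (SOME ys. mset ys = G)"

definition GL_prod :: "('d, 'k::field) GL \<Rightarrow> ('d, 'k) GL \<Rightarrow> ('d, 'k) GL" (infixl \<open>\<star>\<close> 70) where
  "GL_prod p q = lin (\<lambda>F. lin (\<lambda>G. GL_forest F G) q) p"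

definition GL_prod_list :: "('d, 'k::field) GL list \<Rightarrow> ('d, 'k) GL" where
  "GL_prod_list ps = foldr GL_prod ps (forest_vec {#})"

definition nested_graft :: "'d rtree list \<Rightarrow> 'd rtree \<Rightarrow> ('d, 'k::field) TT" where
  "nested_graft as b = foldr (\<lambda>a acc. graft (tree_vec a) acc) as (tree_vec b)"

text \<open>For a block P = {p_1 < \<cdots> < p_h}:
  t_P = sum over \<sigma> \<in> S_{h-1} of t_{p_\<sigma>(1)} \<curvearrowleft> (\<cdots> \<curvearrowleft> (t_{p_\<sigma>(h-1)} \<curvearrowleft> t_{p_h})).
  (Indices are 0-based here: p_j = ps ! (j-1).)\<close>
definition t_block :: "(nat \<Rightarrow> 'd rtree) \<Rightarrow> nat set \<Rightarrow> ('d, 'k::field) TT" where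
  "t_block t P =
     (let ps = sorted_list_of_set P; h = length ps in
      \<Sum>\<sigma> \<in> {\<sigma>. \<sigma> permutes {..<h - 1}}.
        nested_graft (map (\<lambda>j. t (ps ! \<sigma> j)) [0..<h - 1]) (t (ps ! (h - 1))))"

end

(* On the polynomial algebra GL, grafting y onto a tree extends to a derivation der y, and right
   multiplication by a tree is p \<star> y = p * y + der y p. Hence, for a monomial t_A = \<Prod>_{a \<in> A} t_a,
     t_A * x = t_A \<star> x - \<Sum>_{a \<in> A} t_{A - a} * (t_a \<curvearrowleft> x),
   and iterating this turns t_A * x into an alternating sum of the products of t_{A - I}, for
   I \<subseteq> A, with the sum of the nested graftings of the trees of I onto x. Taking for x the tree of
   largest index, I together with that index is the last block of the partition, and induction
   treats A - I. Reassembling the product needs associativity only for (s \<star> p) \<star> y with s and y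
   trees; it follows from the compatibility of grafting of forests with der. *)

theory Submission
  imports Defs "HOL-Combinatorics.Multiset_Permutations"
begin

subsection \<open>Linear maps between spaces of finitely supported functions\<close>

text \<open>Linearity over \<open>'k\<close> is a predicate on maps, phrased through
  \<open>smult\<close>, so that multilinear identities can be reduced to single trees and forests
  one argument at a time.\<close>

definition linmap :: "(('a \<Rightarrow>\<^sub>0 'k::field) \<Rightarrow> ('b \<Rightarrow>\<^sub>0 'k)) \<Rightarrow> bool" where
  "linmap f \<longleftrightarrow> (\<forall>p q. f (p + q) = f p + f q) \<and> (\<forall>c p. f (smult c p) = smult c (f p))"

lemma lookup_smult [simp]: "Poly_Mapping.lookup (smult c p) a = c * Poly_Mapping.lookup p a"
  by (simp add: smult_def Poly_Mapping.map.rep_eq when_def)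

lemma smult_add_right: "smult c (p + q) = smult c p + smult c q"
  by (rule poly_mapping_eqI) (simp add: lookup_add algebra_simps)

lemma smult_add_left: "smult (c + d) p = smult c p + smult d p"
  by (rule poly_mapping_eqI) (simp add: lookup_add algebra_simps)

lemma smult_smult: "smult c (smult d p) = smult (c * d) p"
  by (rule poly_mapping_eqI) (simp add: algebra_simps)

lemma smult_one [simp]: "smult 1 p = p"
  by (rule poly_mapping_eqI) simp

lemma smult_zero_right [simp]: "smult c 0 = 0"
  by (rule poly_mapping_eqI) simp

lemma smult_zero_left [simp]: "smult 0 p = 0"
  by (rule poly_mapping_eqI) simp

lemma smult_neg_one: "smult (- 1) p = - p"
  by (rule poly_mapping_eqI) simp

lemma smult_minus_left: "smult (- c) p = - smult c p"
  by (rule poly_mapping_eqI) simp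

lemma smult_mult_left:
  "smult c p * q = smult c (p * q)" for p q :: "'a::monoid_add \<Rightarrow>\<^sub>0 'k::field"
  by (simp add: smult_def mult_map_scale_conv_mult mult.assoc)

lemma smult_mult_right:
  "p * smult c q = smult c (p * q)" for p q :: "'a::comm_monoid_add \<Rightarrow>\<^sub>0 'k::field"
  by (simp add: smult_def mult_map_scale_conv_mult mult.left_commute)

lemma linmap_add: "linmap f \<Longrightarrow> f (p + q) = f p + f q"
  by (simp add: linmap_def)

lemma linmap_smult: "linmap f \<Longrightarrow> f (smult c p) = smult c (f p)"
  by (simp add: linmap_def)

lemma linmap_zero: "linmap f \<Longrightarrow> f 0 = 0"
  using linmap_smult[of f 0 0] by simp

lemma linmap_minus: "linmap f \<Longrightarrow> f (- p) = - f p"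
  using linmap_smult[of f "- 1" p] by (simp add: smult_neg_one)

lemma linmap_diff: "linmap f \<Longrightarrow> f (p - q) = f p - f q"
  using linmap_add[of f p "- q"] by (simp add: linmap_minus)

lemma linmap_sum: "linmap f \<Longrightarrow> f (\<Sum>i\<in>A. g i) = (\<Sum>i\<in>A. f (g i))"
  by (induction A rule: infinite_finite_induct) (simp_all add: linmap_zero linmap_add)

lemma linmap_sum_mset: "linmap f \<Longrightarrow> f (\<Sum>i\<in>#A. g i) = (\<Sum>i\<in>#A. f (g i))"
  by (induction A) (simp_all add: linmap_zero linmap_add)

lemma linmap_scale: "linmap (smult c)"
  by (simp add: linmap_def smult_add_right smult_smult mult.commute)

lemma poly_mapping_decompose:
  "p = (\<Sum>a\<in>Poly_Mapping.keys p. smult (Poly_Mapping.lookup p a) (Poly_Mapping.single a 1))"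
proof (rule poly_mapping_eqI)
  fix b
  show "Poly_Mapping.lookup p b = Poly_Mapping.lookup
    (\<Sum>a\<in>Poly_Mapping.keys p. smult (Poly_Mapping.lookup p a) (Poly_Mapping.single a 1)) b"
    by (auto simp: lookup_sum lookup_single when_def in_keys_iff if_distrib sum.delta cong: if_cong)
qed

text \<open>This version, local to the support of \<open>p\<close>, serves identities that are
  available only for basis vectors of bounded degree.\<close>

lemma linmap_ext_keys:
  assumes "linmap f" "linmap g"
    and "\<And>a. a \<in> Poly_Mapping.keys p \<Longrightarrow> f (Poly_Mapping.single a 1) = g (Poly_Mapping.single a 1)"
  shows "f p = g p"
  by (subst (1 2) poly_mapping_decompose[of p])
     (simp add: assms linmap_sum linmap_smult del: lookup_smult)

lemma linmap_ext:
  assumes "linmap f" "linmap g"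
    and "\<And>a. f (Poly_Mapping.single a 1) = g (Poly_Mapping.single a 1)"
  shows "f p = g p"
  using assms by (rule linmap_ext_keys)

text \<open>Cancellation can shrink the support of a sum; summing over a common finite superset lets
  \<open>linmap_lin\<close> ignore this.\<close>

lemma lin_superset:
  assumes "finite S" "Poly_Mapping.keys p \<subseteq> S"
  shows "lin f p = (\<Sum>a\<in>S. smult (Poly_Mapping.lookup p a) (f a))"
  unfolding lin_def using assms by (intro sum.mono_neutral_left) (auto simp: in_keys_iff)

lemma linmap_lin: "linmap (lin f)"
  unfolding linmap_def
proof (intro conjI allI)
  fix p q :: "'a \<Rightarrow>\<^sub>0 'b"
  let ?S = "Poly_Mapping.keys p \<union> Poly_Mapping.keys q"
  have "Poly_Mapping.keys (p + q) \<subseteq> ?S" by (rule Poly_Mapping.keys_add)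
  then show "lin f (p + q) = lin f p + lin f q"
    by (simp add: lin_superset[of ?S] lookup_add smult_add_left sum.distrib)
next
  fix c :: 'b and p :: "'a \<Rightarrow>\<^sub>0 'b"
  have "Poly_Mapping.keys (smult c p) \<subseteq> Poly_Mapping.keys p" by (auto simp: in_keys_iff)
  then show "lin f (smult c p) = smult c (lin f p)"
    by (simp add: lin_superset[of "Poly_Mapping.keys p"] linmap_sum[OF linmap_scale] smult_smult)
qed

lemma lin_single [simp]: "lin f (Poly_Mapping.single a 1) = f a"
  by (simp add: lin_def)

lemma lin_add_fun: "lin (\<lambda>a. f a + g a) p = lin f p + lin g p"
  by (simp add: lin_def smult_add_right sum.distrib)

lemma linmap_compose: "linmap f \<Longrightarrow> linmap g \<Longrightarrow> linmap (\<lambda>p. f (g p))"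
  by (simp add: linmap_def)

lemma linmap_compose_lin: "linmap g \<Longrightarrow> linmap (\<lambda>p. lin f (g p))"
  by (rule linmap_compose[OF linmap_lin])

lemma linmap_fun_lin: "(\<And>a. linmap (\<lambda>p. h p a)) \<Longrightarrow> linmap (\<lambda>p. lin (h p) q)"
  by (simp add: linmap_def lin_def smult_add_right sum.distrib linmap_sum[OF linmap_scale]
      smult_smult mult.commute)

lemma linmap_id: "linmap (\<lambda>p. p)"
  by (simp add: linmap_def)

lemma linmap_zero_fun: "linmap (\<lambda>p. 0)"
  by (simp add: linmap_def)

lemma linmap_plus: "linmap f \<Longrightarrow> linmap g \<Longrightarrow> linmap (\<lambda>p. f p + g p)"
  by (simp add: linmap_def smult_add_right algebra_simps)

lemma linmap_uminus: "linmap f \<Longrightarrow> linmap (\<lambda>p. - f p)"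
  by (simp add: linmap_def smult_smult mult.commute flip: smult_neg_one)
     (simp add: smult_add_right)

lemma linmap_sub: "linmap f \<Longrightarrow> linmap g \<Longrightarrow> linmap (\<lambda>p. f p - g p)"
  using linmap_plus[of f "\<lambda>p. - g p"] linmap_uminus[of g] by simp

lemma linmap_sum_fun: "(\<And>i. i \<in> A \<Longrightarrow> linmap (f i)) \<Longrightarrow> linmap (\<lambda>p. \<Sum>i\<in>A. f i p)"
  by (induction A rule: infinite_finite_induct) (simp_all add: linmap_zero_fun linmap_plus)

lemma linmap_sum_mset_fun: "(\<And>i. linmap (f i)) \<Longrightarrow> linmap (\<lambda>p. \<Sum>i\<in>#A. f i p)"
  by (induction A) (simp_all add: linmap_zero_fun linmap_plus)

lemma linmap_mult_right:
  "linmap f \<Longrightarrow> linmap (\<lambda>p. f p * q)" for q :: "'a::monoid_add \<Rightarrow>\<^sub>0 'k::field"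
  by (simp add: linmap_def smult_mult_left algebra_simps)

lemma linmap_mult_left:
  "linmap f \<Longrightarrow> linmap (\<lambda>p. q * f p)" for q :: "'a::comm_monoid_add \<Rightarrow>\<^sub>0 'k::field"
  by (simp add: linmap_def smult_mult_right algebra_simps)

lemmas linmap_intros = linmap_lin linmap_compose_lin linmap_fun_lin linmap_id linmap_zero_fun
  linmap_plus linmap_uminus linmap_sub linmap_sum_fun linmap_sum_mset_fun
  linmap_mult_right linmap_mult_left

subsection \<open>The pre-Lie structure and the derivations of the forest algebra\<close>

lemma linmap_T_to_GL: "linmap T_to_GL"
  unfolding T_to_GL_def[abs_def] by (rule linmap_lin)

lemma T_to_GL_single [simp]: "T_to_GL (tree_vec t) = forest_vec {#t#}"
  by (simp add: T_to_GL_def)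

lemma linmap_T_to_GL_compose: "linmap f \<Longrightarrow> linmap (\<lambda>p. T_to_GL (f p))"
  by (rule linmap_compose[OF linmap_T_to_GL])

lemma linmap_graft_left: "linmap f \<Longrightarrow> linmap (\<lambda>p. graft (f p) q)"
  unfolding graft_def[abs_def] by (intro linmap_intros)

lemma linmap_graft_right: "linmap f \<Longrightarrow> linmap (\<lambda>p. graft q (f p))"
  unfolding graft_def[abs_def] by (intro linmap_intros)

lemma graft_single [simp]: "graft (tree_vec s) (tree_vec t) = graft_tree s t"
  by (simp add: graft_def)

lemma graft_single_right: "graft p (tree_vec t) = lin (\<lambda>s. graft_tree s t) p"
  by (simp add: graft_def)

lemma forest_vec_mult: "forest_vec F * forest_vec G = (forest_vec (F + G) :: ('d, 'k::field) GL)"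
  by (simp add: mult_single)

text \<open>Forests form an additive monoid, so convolution of finitely supported functions is
  exactly juxtaposition. From here on the commutative ring structure of the polynomial algebra is at
  hand.\<close>

lemma forest_mult_eq: "forest_mult p q = p * q"
proof -
  have "forest_mult p (forest_vec G) = p * forest_vec G" for G
    by (rule linmap_ext[of "\<lambda>p. forest_mult p (forest_vec G)" "\<lambda>p. p * forest_vec G"])
       (simp_all add: forest_mult_def linmap_intros forest_vec_mult)
  then show ?thesis
    by (intro linmap_ext[of "forest_mult p" "\<lambda>q. p * q" q])
       (auto simp: forest_mult_def[abs_def] intro!: linmap_intros)
qed

section \<open>Derivations induced by grafting\<close>

definition der :: "('d, 'k::field) TT \<Rightarrow> ('d, 'k) GL \<Rightarrow> ('d, 'k) GL" where
  "der b p =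
     lin (\<lambda>F. \<Sum>c\<in>#F. forest_vec (F - {#c#}) * T_to_GL (graft (tree_vec c) b)) p"

text \<open>The linear operator usually written B_+, which joins the trees of a forest to a new
  root.\<close>

definition node :: "'d \<Rightarrow> ('d, 'k::field) GL \<Rightarrow> ('d, 'k) TT" where
  "node d p = lin (\<lambda>F. tree_vec (Node d F)) p"

lemma linmap_der: "linmap f \<Longrightarrow> linmap (\<lambda>p. der b (f p))"
  unfolding der_def[abs_def] by (intro linmap_intros)

lemma linmap_der_left: "linmap f \<Longrightarrow> linmap (\<lambda>b. der (f b) p)"
  unfolding der_def[abs_def]
  by (intro linmap_intros linmap_T_to_GL_compose linmap_graft_right)

lemma linmap_node: "linmap f \<Longrightarrow> linmap (\<lambda>p. node d (f p))"
  unfolding node_def[abs_def] by (intro linmap_intros)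

lemmas linmap_GL_intros = linmap_intros linmap_T_to_GL linmap_T_to_GL_compose linmap_graft_left
  linmap_graft_right linmap_der linmap_der_left linmap_node

lemma der_forest_vec:
  "der b (forest_vec F) = (\<Sum>c\<in>#F. forest_vec (F - {#c#}) * T_to_GL (graft (tree_vec c) b))"
  by (simp add: der_def)

lemma der_one [simp]: "der b 1 = 0"
  by (simp add: der_def flip: single_one)

text \<open>The factor that receives the grafting lies in \<open>F\<close> or in \<open>G\<close>,
  and the sum splits accordingly, multiplicities included.\<close>

lemma der_forest_vec_mult:
  "der b (forest_vec (F + G)) =
     der b (forest_vec F) * forest_vec G + forest_vec F * der b (forest_vec G)"
proof -
  have "(\<Sum>c\<in>#F. forest_vec (F + G - {#c#}) * T_to_GL (graft (tree_vec c) b)) =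
      (\<Sum>c\<in>#F. forest_vec (F - {#c#}) * T_to_GL (graft (tree_vec c) b)) * forest_vec G"
    unfolding sum_mset_distrib_right
    by (rule arg_cong[where f = sum_mset], rule image_mset_cong)
       (auto dest!: multi_member_split simp: forest_vec_mult[symmetric] mult_ac)
  moreover have "(\<Sum>c\<in>#G. forest_vec (F + G - {#c#}) * T_to_GL (graft (tree_vec c) b)) =
      forest_vec F * (\<Sum>c\<in>#G. forest_vec (G - {#c#}) * T_to_GL (graft (tree_vec c) b))"
    unfolding sum_mset_distrib_left
    by (rule arg_cong[where f = sum_mset], rule image_mset_cong)
       (auto dest!: multi_member_split simp: forest_vec_mult[symmetric] mult_ac)
  ultimately show ?thesis by (simp add: der_forest_vec)
qed

lemma der_mult: "der b (p * q) = der b p * q + p * der b q"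
proof -
  have "der b (p * forest_vec G) = der b p * forest_vec G + p * der b (forest_vec G)" for G
    by (rule linmap_ext[of "\<lambda>p. der b (p * forest_vec G)"
          "\<lambda>p. der b p * forest_vec G + p * der b (forest_vec G)"])
       (auto simp: forest_vec_mult der_forest_vec_mult intro!: linmap_GL_intros)
  then show ?thesis
    by - (rule linmap_ext[of "\<lambda>q. der b (p * q)" "\<lambda>q. der b p * q + p * der b q"],
        (intro linmap_GL_intros)+, assumption)
qed

lemma der_T_to_GL: "der b (T_to_GL a) = T_to_GL (graft a b)"
  by (rule linmap_ext[of "\<lambda>a. der b (T_to_GL a)" "\<lambda>a. T_to_GL (graft a b)"])
     (auto simp: der_forest_vec intro!: linmap_GL_intros)

lemma node_single [simp]: "node d (forest_vec F) = tree_vec (Node d F)"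
  by (simp add: node_def)

text \<open>A vertex is either the root, which gains \<open>b\<close> as a further subtree, or a
  vertex of a subtree, which is the action of \<open>der b\<close>. This turns the recursion of
  \<open>graft_tree\<close> into algebra.\<close>

lemma graft_node: "graft (node d p) b = node d (p * T_to_GL b + der b p)"
proof -
  have aux: "lin (\<lambda>c'. tree_vec (Node d (add_mset c' F))) q = node d (forest_vec F * T_to_GL q)"
    for q :: "('a, 'b) TT" and F
    by (rule linmap_ext[of "lin (\<lambda>c'. tree_vec (Node d (add_mset c' F)))"
          "\<lambda>q. node d (forest_vec F * T_to_GL q)"])
       (auto simp: forest_vec_mult intro!: linmap_GL_intros)
  have "graft (tree_vec (Node d F)) (tree_vec t) =
      (node d (forest_vec F * forest_vec {#t#} + der (tree_vec t) (forest_vec F)) :: ('a, 'b) TT)"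
    for F t
    by (simp add: linmap_add[OF linmap_node[OF linmap_id]]
        linmap_sum_mset[OF linmap_node[OF linmap_id]] der_forest_vec forest_vec_mult aux)
  then have "graft (tree_vec (Node d F)) b =
      node d (forest_vec F * T_to_GL b + der b (forest_vec F))" for F
    by - (rule linmap_ext[of "graft (tree_vec (Node d F))"
          "\<lambda>b. node d (forest_vec F * T_to_GL b + der b (forest_vec F))"],
        (intro linmap_GL_intros)+, simp)
  then show ?thesis
    by - (rule linmap_ext[of "\<lambda>p. graft (node d p) b" "\<lambda>p. node d (p * T_to_GL b + der b p)"],
        (intro linmap_GL_intros)+, simp)
qed

section \<open>Symmetry of the associator: the pre-Lie identity\<close>

definition der2 :: "('d, 'k::field) TT \<Rightarrow> ('d, 'k) TT \<Rightarrow> ('d, 'k) GL \<Rightarrow> ('d, 'k) GL" where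
  "der2 y z p = der z (der y p) - der (graft y z) p"

lemma forest_vec_add_mset:
  "forest_vec (add_mset c F) = T_to_GL (tree_vec c) * (forest_vec F :: ('d, 'k::field) GL)"
  by (simp add: forest_vec_mult)

lemma der_add: "der b (p + q) = der b p + der b q"
  by (rule linmap_add[OF linmap_der[OF linmap_id]])

lemma T_to_GL_diff: "T_to_GL (p - q) = T_to_GL p - T_to_GL q"
  by (rule linmap_diff[OF linmap_T_to_GL])

lemma der_zero [simp]: "der b 0 = 0"
  by (rule linmap_zero[OF linmap_der[OF linmap_id]])

text \<open>The terms by which \<open>der2 y z\<close> fails to be a derivation are symmetric in
  \<open>y\<close> and \<open>z\<close>; hence symmetry of \<open>der2\<close> passes from trees to
  products.\<close>

lemma der2_mult:
  "der2 y z (p * q) = der2 y z p * q + p * der2 y z q + der y p * der z q + der z p * der y q"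
  by (simp add: der2_def der_mult der_add algebra_simps)

lemma der2_T_to_GL:
  "der2 y z (T_to_GL a) = T_to_GL (graft (graft a y) z - graft a (graft y z))"
  by (simp add: der2_def der_T_to_GL T_to_GL_diff)

text \<open>The assumption concerns the trees of \<open>F\<close> only, because this is what
  structural induction on a tree offers for its subtrees.\<close>

lemma der2_commute_forest:
  assumes "\<And>c. c \<in># F \<Longrightarrow> graft (graft (tree_vec c) y) z - graft (tree_vec c) (graft y z) =
    graft (graft (tree_vec c) z) y - graft (tree_vec c) (graft z y)"
  shows "der2 y z (forest_vec F) = der2 z y (forest_vec F)"
  using assms
proof (induction F)
  case empty
  then show ?case by (simp add: der2_def der_forest_vec)
next
  case (add c F)
  have "der2 y z (T_to_GL (tree_vec c)) = der2 z y (T_to_GL (tree_vec c))"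
    unfolding der2_T_to_GL using add.prems[of c] by simp
  moreover have "der2 y z (forest_vec F) = der2 z y (forest_vec F)"
    using add by simp
  ultimately show ?case
    unfolding forest_vec_add_mset der2_mult by (simp add: add_ac)
qed

text \<open>Apart from the \<open>der2\<close> term, the right-hand side is visibly symmetric in
  \<open>y\<close> and \<open>z\<close>. The pre-Lie identity at a root thus reduces to symmetry of
  \<open>der2\<close> on the forest of subtrees.\<close>

lemma graft_node_assoc:
  "graft (graft (node d p) y) z - graft (node d p) (graft y z) =
     node d (p * T_to_GL y * T_to_GL z + der y p * T_to_GL z + der z p * T_to_GL y + der2 y z p)"
  by (simp add: graft_node flip: linmap_diff[OF linmap_node[OF linmap_id]])
     (simp add: der2_def der_add der_mult der_T_to_GL algebra_simps)

lemma pre_Lie_tree: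
  "graft (graft (tree_vec a) y) z - graft (tree_vec a) (graft y z) =
     graft (graft (tree_vec a) z) y - graft (tree_vec a) (graft z y)"
proof (induction a)
  case (Node d cs)
  then have "der2 y z (forest_vec cs) = der2 z y (forest_vec cs)"
    by (rule der2_commute_forest)
  then show ?case
    unfolding node_single[symmetric] graft_node_assoc by (simp add: algebra_simps)
qed

lemma pre_Lie:
  "graft (graft a y) z - graft a (graft y z) = graft (graft a z) y - graft a (graft z y)"
  by (rule linmap_ext[of "\<lambda>a. graft (graft a y) z - graft a (graft y z)"
        "\<lambda>a. graft (graft a z) y - graft a (graft z y)"],
      (intro linmap_GL_intros)+, rule pre_Lie_tree)

lemma der2_commute: "der2 y z p = der2 z y p"
proof -
  have "linmap (der2 y z)" for y z :: "('a, 'b) TT"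
    unfolding der2_def[abs_def] by (intro linmap_GL_intros)
  then show ?thesis
    by - (rule linmap_ext[of "der2 y z" "der2 z y"], simp_all add: der2_commute_forest[OF pre_Lie_tree])
qed

subsection \<open>Grafting of forests\<close>

text \<open>The recursion defining \<open>graft_rev\<close>, read on the polynomial algebra, says that the linear
  extension of \<open>t \<curvearrowleft> \<cdot>\<close> turns \<open>p * y + der y p\<close> into \<open>(t \<curvearrowleft> p) \<curvearrowleft> y\<close>.
  Since \<open>der2\<close> and the associator of the grafting are symmetric, the order of the
  factors is irrelevant.\<close>

lemma lin_update_sum_der:
  "(\<Sum>i<length ys. lin (\<lambda>s. f (mset (ys[i := s]))) (graft_tree (ys ! i) y)) =
     lin f (der (tree_vec y) (forest_vec (mset ys)))"
  (is "?L = ?R")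
proof -
  have *: "lin (\<lambda>s. f (add_mset s F)) q = lin f (forest_vec F * T_to_GL q)" for q F
    by (rule linmap_ext[of "lin (\<lambda>s. f (add_mset s F))" "\<lambda>q. lin f (forest_vec F * T_to_GL q)"],
        (intro linmap_GL_intros)+) (simp add: forest_vec_mult)
  have "?L = (\<Sum>i<length ys. lin f (forest_vec (mset ys - {#ys ! i#}) * T_to_GL (graft_tree (ys ! i) y)))"
    by (rule sum.cong) (simp_all add: mset_update *)
  also have "\<dots> = (\<Sum>c\<leftarrow>ys. lin f (forest_vec (mset ys - {#c#}) * T_to_GL (graft_tree c y)))"
    by (simp add: sum_list_sum_nth atLeast0LessThan)
  also have "\<dots> = (\<Sum>c\<in>#mset ys. lin f (forest_vec (mset ys - {#c#}) * T_to_GL (graft_tree c y)))"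
    by (simp add: sum_mset_sum_list flip: mset_map)
  also have "\<dots> = ?R"
    by (simp add: der_forest_vec linmap_sum_mset[OF linmap_lin])
  finally show ?thesis .
qed

text \<open>An arbitrary enumeration is chosen and used without reversal; its irrelevance is the
  content of \<open>graft_rev_mset\<close>.\<close>

definition graft_mset :: "'d rtree \<Rightarrow> 'd forest \<Rightarrow> ('d, 'k::field) TT" where
  "graft_mset t F = graft_rev t (SOME ys. mset ys = F)"

lemma keys_lin:
  fixes f :: "'a \<Rightarrow> 'b \<Rightarrow>\<^sub>0 'k::field"
  shows "Poly_Mapping.keys (lin f p) \<subseteq> (\<Union>a. Poly_Mapping.keys (f a))"
proof -
  have "Poly_Mapping.keys (smult c q) \<subseteq> Poly_Mapping.keys q" for c and q :: "'b \<Rightarrow>\<^sub>0 'k"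
    by (auto simp: in_keys_iff)
  then show ?thesis
    unfolding lin_def by (intro order_trans[OF keys_sum]) blast
qed

lemma keys_sum_mset: "Poly_Mapping.keys (\<Sum>c\<in>#M. f c) \<subseteq> (\<Union>c\<in>set_mset M. Poly_Mapping.keys (f c))"
  by (induction M) (use Poly_Mapping.keys_add in fastforce)+

text \<open>A derivation replaces one tree by a combination of single trees. Degree bounds therefore
  survive \<open>der\<close>, which the expansion in \<open>graft_rev_swap\<close> relies
  on.\<close>

lemma size_keys_der:
  fixes b :: "('d, 'k::field) TT"
  assumes "G \<in> Poly_Mapping.keys (der b (forest_vec F))"
  shows "size G = size F"
proof -
  obtain c where c: "c \<in># F"
    and "G \<in> Poly_Mapping.keys (forest_vec (F - {#c#}) * T_to_GL (graft (tree_vec c) b))"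
    using assms keys_sum_mset unfolding der_forest_vec by fastforce
  then obtain H where "H \<in> Poly_Mapping.keys (T_to_GL (graft (tree_vec c) b) :: ('d, 'k) GL)"
    and G: "G = F - {#c#} + H"
    using keys_mult[of "forest_vec (F - {#c#})" "T_to_GL (graft (tree_vec c) b)"] by auto
  then have "size H = 1"
    using keys_lin[of "\<lambda>t. forest_vec {#t#}" "graft (tree_vec c) b"] by (auto simp: T_to_GL_def)
  then show ?thesis
    using c G by (metis One_nat_def size_Diff_singleton size_Suc_Diff1 size_union
        add.commute plus_1_eq_Suc)
qed

text \<open>The assumption \<open>graft_rev_short\<close> is the induction hypothesis of
  \<open>graft_rev_mset\<close>: up to \<open>n\<close> factors, the order is irrelevant.
  \<open>A\<close> extends the grafting of forests onto \<open>t\<close> linearly.\<close>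

context
  fixes A :: "('d, 'k::field) GL \<Rightarrow> ('d, 'k) TT" and t :: "'d rtree" and n :: nat
  defines "A \<equiv> lin (graft_mset t)"
  assumes graft_rev_short: "\<And>ys. length ys \<le> n \<Longrightarrow> (graft_rev t ys :: ('d, 'k) TT) = graft_mset t (mset ys)"
begin

lemma linmap_graft_mset: "linmap f \<Longrightarrow> linmap (\<lambda>p. A (f p))"
  unfolding A_def by (rule linmap_compose_lin)

lemma graft_rev_Cons:
  assumes "length ys \<le> n"
  shows "graft_rev t (y # ys) =
    graft (A (forest_vec (mset ys))) (tree_vec y) - A (der (tree_vec y) (forest_vec (mset ys)))"
proof -
  have "(\<Sum>i<length ys. lin (\<lambda>s. graft_rev t (ys[i := s])) (graft_tree (ys ! i) y)) =
      (\<Sum>i<length ys. lin (\<lambda>s. graft_mset t (mset (ys[i := s]))) (graft_tree (ys ! i) y) :: ('d, 'k) TT)"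
    using assms by (simp add: graft_rev_short)
  then show ?thesis
    using assms by (simp add: graft_rev_short graft_single_right lin_update_sum_der A_def)
qed

text \<open>The strict bound leaves room for one more factor, so the product still lies in the
  degrees where the order is irrelevant.\<close>

lemma graft_mset_mult_T_to_GL:
  assumes "\<And>F. F \<in> Poly_Mapping.keys p \<Longrightarrow> size F < n"
  shows "A (p * T_to_GL z) = graft (A p) z - A (der z p)"
proof (rule linmap_ext_keys[where p = p])
  fix F assume "F \<in> Poly_Mapping.keys p"
  then have F: "size F < n" by (rule assms)
  obtain ws where ws: "mset ws = F" using ex_mset by blast
  have "A (forest_vec F * T_to_GL (tree_vec z)) =
      graft (A (forest_vec F)) (tree_vec z) - A (der (tree_vec z) (forest_vec F))" for z
    using F ws graft_rev_short[of "z # ws"] graft_rev_Cons[of ws z]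
    by (auto simp: forest_vec_mult A_def)
  then show "A (forest_vec F * T_to_GL z) = graft (A (forest_vec F)) z - A (der z (forest_vec F))"
    by - (rule linmap_ext[of "\<lambda>z. A (forest_vec F * T_to_GL z)"
          "\<lambda>z. graft (A (forest_vec F)) z - A (der z (forest_vec F))"],
        (intro linmap_GL_intros linmap_graft_mset)+, assumption)
qed (intro linmap_GL_intros linmap_graft_mset)+

lemma graft_rev_swap:
  assumes "length ws < n"
  shows "graft_rev t (y # z # ws) = (graft_rev t (z # y # ws) :: ('d, 'k) TT)"
proof -
  define w where "w = (forest_vec (mset ws) :: ('d, 'k) GL)"
  have deg: "F \<in> Poly_Mapping.keys w \<Longrightarrow> size F < n"
    "F \<in> Poly_Mapping.keys (der y w) \<Longrightarrow> size F < n" for F y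
    using assms size_keys_der by (fastforce simp: w_def)+
  have A_add: "A (p + q) = A p + A q" and A_diff: "A (p - q) = A p - A q" for p q
    using linmap_graft_mset[OF linmap_id] by (simp_all add: linmap_add linmap_diff)
  have graft_diff: "graft (p - q) r = graft p r - graft q r" for p q r :: "('d, 'k) TT"
    by (rule linmap_diff[OF linmap_graft_left[OF linmap_id]])
  \<comment> \<open>The recursion is expanded twice and sorted so that each line is symmetric in
    \<open>y\<close> and \<open>z\<close>: the first by \<open>pre_Lie\<close>, the second at sight,
    the third by \<open>der2_commute\<close>.\<close>
  have swap: "graft_rev t (y # z # ws) =
      (graft (graft (A w) z') y' - graft (A w) (graft z' y'))
      - graft (A (der z' w)) y' - graft (A (der y' w)) z'
      + A (der2 y' z' w) + A (der (graft y' z') w) + A (der (graft z' y') w)"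
    if "y' = tree_vec y" "z' = tree_vec z" for y z y' z'
  proof -
    have "graft_rev t (y # z # ws) = graft (A (w * T_to_GL z')) y' - A (der y' (w * T_to_GL z'))"
      using graft_rev_Cons[of "z # ws" y] assms by (simp add: that w_def forest_vec_mult)
    also have "der y' (w * T_to_GL z') = der y' w * T_to_GL z' + w * T_to_GL (graft z' y')"
      by (simp only: der_mult der_T_to_GL)
    finally show ?thesis
      by (simp add: A_add A_diff graft_mset_mult_T_to_GL[OF deg(1)] graft_mset_mult_T_to_GL[OF deg(2)] der2_def graft_diff
          del: graft_rev.simps graft_single)
  qed
  show ?thesis
    unfolding swap[OF refl refl] pre_Lie[of _ "tree_vec y" "tree_vec z"]
      der2_commute[of "tree_vec y" "tree_vec z"]
    by (simp add: algebra_simps)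
qed

end

lemma graft_rev_mset:
  "graft_rev t ys = (graft_mset t (mset ys) :: ('d, 'k::field) TT)"
proof -
  have "\<forall>ys zs. length ys \<le> n \<longrightarrow> mset ys = mset zs \<longrightarrow> graft_rev t ys = (graft_rev t zs :: ('d, 'k) TT)" for n
  proof (induction n)
    case (Suc n)
    have short: "(graft_rev t ys :: ('d, 'k) TT) = graft_mset t (mset ys)" if "length ys \<le> n" for ys
      unfolding graft_mset_def using Suc that by (metis (mono_tags, lifting) someI_ex)
    have Cons: "graft_rev t (y # us) = (graft_rev t (y # vs) :: ('d, 'k) TT)"
      if "length us \<le> n" "mset us = mset vs" for y us vs
      using graft_rev_Cons[of n t us y, OF short] graft_rev_Cons[of n t vs y, OF short] that
      by (metis mset_eq_length)
    show ?case
    proof (intro allI impI)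
      fix ys zs :: "'d rtree list"
      assume len: "length ys \<le> Suc n" and eq: "mset ys = mset zs"
      show "graft_rev t ys = (graft_rev t zs :: ('d, 'k) TT)"
      proof (cases ys)
        case Nil
        with eq show ?thesis by simp
      next
        case ys: (Cons y us)
        with eq obtain z vs where zs: "zs = z # vs" by (cases zs) auto
        show ?thesis
        proof (cases "y = z")
          case True
          with Cons len eq ys zs show ?thesis by simp
        next
          case False
          \<comment> \<open>With different heads, both lists are rearrangements of
            \<open>y # z # ws\<close> for a common \<open>ws\<close>; only the two leading entries
            have to be exchanged, the tails being covered by \<open>Cons\<close>.\<close>
          with eq ys zs have "z \<in># mset us" by (metis add_eq_conv_ex mset.simps(2) union_single_eq_member)
          then obtain M where M: "mset us = add_mset z M" by (metis multi_member_split)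
          obtain ws where ws: "mset ws = M" using ex_mset by blast
          have us: "mset us = mset (z # ws)" and vs: "mset vs = mset (y # ws)"
            using M ws eq ys zs by (auto simp: add_mset_commute)
          have len': "length us \<le> n" "length vs \<le> n" "length ws < n"
            using len ys us vs by (metis Suc_le_mono length_Cons mset_eq_length less_eq_Suc_le)+
          have "graft_rev t ys = (graft_rev t (y # z # ws) :: ('d, 'k) TT)"
            unfolding ys by (rule Cons[OF len'(1) us])
          also have "\<dots> = graft_rev t (z # y # ws)"
            by (rule graft_rev_swap[OF short len'(3)])
          also have "\<dots> = graft_rev t zs"
            unfolding zs by (rule Cons[OF len'(2) vs, symmetric])
          finally show ?thesis .
        qed
      qed
    qed
  qed simp
  then have "mset ys = mset zs \<Longrightarrow> graft_rev t ys = (graft_rev t zs :: ('d, 'k) TT)" for zs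
    by blast
  then show ?thesis
    unfolding graft_mset_def by (metis (mono_tags, lifting) someI_ex)
qed

definition graft_GL :: "'d rtree \<Rightarrow> ('d, 'k::field) GL \<Rightarrow> ('d, 'k) TT" where
  "graft_GL t p = lin (graft_forest t) p"

lemma graft_forest_mset: "graft_forest t (mset ys) = (graft_rev t ys :: ('d, 'k::field) TT)"
proof -
  have "mset (rev (SOME xs. mset xs = mset ys)) = mset ys"
    by (simp add: someI_ex[of "\<lambda>xs. mset xs = mset ys"] exI[of _ ys])
  then show ?thesis
    by (simp add: graft_forest_def graft_forest_list_def graft_rev_mset del: mset_rev)
qed

lemma graft_forest_eq_graft_mset: "graft_forest t = graft_mset t"
proof
  fix F :: "'a forest"
  obtain ys where "mset ys = F" using ex_mset by blast
  then show "graft_forest t F = graft_mset t F"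
    using graft_forest_mset graft_rev_mset by metis
qed

lemma graft_GL_mult:
  "graft_GL t (p * T_to_GL z) = graft (graft_GL t p) z - graft_GL t (der z p)"
proof -
  \<comment> \<open>\<open>n\<close> exceeds every degree in \<open>p\<close>; inserting 0 keeps the
    maximum meaningful for \<open>p = 0\<close>.\<close>
  define n where "n = Suc (Max (insert 0 (size ` Poly_Mapping.keys p)))"
  have "size F < n" if "F \<in> Poly_Mapping.keys p" for F
    using that unfolding n_def by (simp add: less_Suc_eq_le Max_ge_iff)
  then show ?thesis
    unfolding graft_GL_def[abs_def] graft_forest_eq_graft_mset
    by (rule graft_mset_mult_T_to_GL[OF graft_rev_mset])
qed

subsection \<open>The Grossman--Larson product with a tree\<close>

lemma lin_one [simp]: "lin f 1 = f 0"
  using lin_single[of f 0] by simp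

text \<open>One tree \<open>x\<close> either stays in front or is passed to the argument of the
  continuation \<open>K\<close>. In this form the steps for different trees commute, so they can be
  folded over a multiset.\<close>

definition split_step ::
  "'d rtree \<Rightarrow> (('d forest \<Rightarrow> ('d, 'k::field) GL) \<Rightarrow> ('d, 'k) GL) \<Rightarrow>
     ('d forest \<Rightarrow> ('d, 'k) GL) \<Rightarrow> ('d, 'k) GL" where
  "split_step x g = (\<lambda>K. forest_vec {#x#} * g K + g (\<lambda>G. K (add_mset x G)))"

text \<open>The sum of \<open>F\<^sub>0 * K F\<^sub>1\<close> over all ways of splitting the forest \<open>F\<close> into \<open>F\<^sub>0\<close> and
  \<open>F\<^sub>1\<close>, with multiplicities.\<close>
definition split_sum ::
  "'d forest \<Rightarrow> ('d forest \<Rightarrow> ('d, 'k::field) GL) \<Rightarrow> ('d, 'k) GL" where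
  "split_sum F = fold_mset split_step (\<lambda>K. K {#}) F"

interpretation split_step: comp_fun_commute split_step
  by standard (auto simp: fun_eq_iff split_step_def algebra_simps add_mset_commute)

lemma split_sum_empty [simp]: "split_sum {#} K = K {#}"
  by (simp add: split_sum_def)

lemma split_sum_add_mset [simp]:
  "split_sum (add_mset x F) K = forest_vec {#x#} * split_sum F K + split_sum F (\<lambda>G. K (add_mset x G))"
  by (simp add: split_sum_def) (simp add: split_step_def)

lemma linmap_split_sum:
  "(\<And>G. linmap (\<lambda>x. K x G)) \<Longrightarrow> linmap (\<lambda>x. split_sum F (K x))"
proof (induction F arbitrary: K)
  case empty
  then show ?case by simp
next
  case (add y F)
  show ?case
    unfolding split_sum_add_mset by (intro linmap_GL_intros add)
qed

text \<open>For linear \<open>K\<close> this is the convolution of the identity with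
  \<open>K\<close> for the unshuffle coproduct of the symmetric algebra.\<close>

definition split_GL ::
  "(('d, 'k::field) GL \<Rightarrow> ('d, 'k) GL) \<Rightarrow> ('d, 'k) GL \<Rightarrow> ('d, 'k) GL" where
  "split_GL K p = lin (\<lambda>F. split_sum F (\<lambda>G. K (forest_vec G))) p"

lemma linmap_split_GL: "linmap f \<Longrightarrow> linmap (\<lambda>p. split_GL K (f p))"
  unfolding split_GL_def[abs_def] by (rule linmap_compose_lin)

lemma linmap_split_GL_left: "(\<And>q. linmap (\<lambda>x. K x q)) \<Longrightarrow> linmap (\<lambda>x. split_GL (K x) p)"
  unfolding split_GL_def[abs_def] by (intro linmap_fun_lin linmap_split_sum)

lemma split_GL_forest_vec: "split_GL K (forest_vec F) = split_sum F (\<lambda>G. K (forest_vec G))"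
  by (simp add: split_GL_def)

lemma split_GL_one [simp]: "split_GL K 1 = K 1"
  using split_GL_forest_vec[of K "{#}"] by simp

lemma split_sum_add_fun:
  "split_sum F (\<lambda>G. K G + L G) = split_sum F K + split_sum F L"
  by (induction F arbitrary: K L) (simp_all add: algebra_simps)

lemma split_GL_add_fun: "split_GL (\<lambda>q. K q + L q) p = split_GL K p + split_GL L p"
  by (simp add: split_GL_def split_sum_add_fun lin_add_fun)

lemma split_sum_zero_fun: "split_sum F (\<lambda>G. 0) = 0"
  by (induction F) simp_all

lemma split_GL_zero_fun: "split_GL (\<lambda>q. 0) p = 0"
  by (simp add: split_GL_def split_sum_zero_fun linmap_def)
     (simp add: lin_def)

text \<open>A tree is primitive for the unshuffle coproduct: it goes entirely to one of the two
  parts.\<close>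

lemma split_GL_mult_tree:
  "split_GL K (forest_vec {#x#} * p) =
     forest_vec {#x#} * split_GL K p + split_GL (\<lambda>q. K (forest_vec {#x#} * q)) p"
  by (rule linmap_ext[of "\<lambda>p. split_GL K (forest_vec {#x#} * p)"
        "\<lambda>p. forest_vec {#x#} * split_GL K p + split_GL (\<lambda>q. K (forest_vec {#x#} * q)) p"],
      (intro linmap_GL_intros linmap_split_GL)+, simp add: split_GL_forest_vec forest_vec_mult)

lemma split_GL_mult:
  assumes "linmap K"
  shows "split_GL K (T_to_GL x * p) =
    T_to_GL x * split_GL K p + split_GL (\<lambda>q. K (T_to_GL x * q)) p"
  by (rule linmap_ext[of "\<lambda>x. split_GL K (T_to_GL x * p)"
        "\<lambda>x. T_to_GL x * split_GL K p + split_GL (\<lambda>q. K (T_to_GL x * q)) p"],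
      (intro linmap_GL_intros linmap_split_GL linmap_split_GL_left linmap_compose[OF assms])+,
      simp add: split_GL_mult_tree)

text \<open>Acting on one tree at a time, \<open>der y\<close> is a coderivation of the unshuffle
  coproduct as well as a derivation. What remains is the commutator of \<open>K\<close> with
  \<open>der y\<close> on the second part.\<close>

lemma split_GL_der_forest:
  assumes "linmap K"
  shows "split_GL K (der y (forest_vec F)) = der y (split_GL K (forest_vec F)) +
    split_GL (\<lambda>q. K (der y q) - der y (K q)) (forest_vec F)"
  using assms
proof (induction F arbitrary: K)
  case empty
  then show ?case
    using linmap_zero[OF linmap_split_GL[OF linmap_id], of K]
    by (simp add: linmap_zero)
next
  case (add c F)
  define x where "x = T_to_GL (tree_vec c :: ('a, 'b) TT)"
  define x' where "x' = T_to_GL (graft (tree_vec c) y)"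
  have lin: "linmap (\<lambda>q. K (z * q))" for z
    by (rule linmap_compose[OF add.prems]) (intro linmap_GL_intros)
  have S_add: "split_GL K (p + q) = split_GL K p + split_GL K q" for K :: "('a, 'b) GL \<Rightarrow> _" and p q
    by (rule linmap_add[OF linmap_split_GL[OF linmap_id]])
  have dx: "der y (x * q) = x' * q + x * der y q" for q
    by (simp add: x_def x'_def der_mult der_T_to_GL del: T_to_GL_single)
  have mult: "split_GL L (x * q) = x * split_GL L q + split_GL (\<lambda>q. L (x * q)) q"
    "split_GL L (x' * q) = x' * split_GL L q + split_GL (\<lambda>q. L (x' * q)) q" if "linmap L" for L q
    unfolding x_def x'_def by (rule split_GL_mult[OF that])+
  have lin': "linmap (\<lambda>q. K (der y q) - der y (K q))"
    by (intro linmap_GL_intros linmap_compose[OF add.prems] add.prems)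
  have "split_GL (\<lambda>q. K (der y (x * q)) - der y (K (x * q))) (forest_vec F) =
      split_GL (\<lambda>q. K (x' * q)) (forest_vec F) +
      split_GL (\<lambda>q. K (x * der y q) - der y (K (x * q))) (forest_vec F)"
    by (simp add: dx linmap_add[OF add.prems] flip: split_GL_add_fun) (simp add: algebra_simps)
  \<comment> \<open>The induction hypothesis is used twice: for \<open>K\<close>, when
    \<open>c\<close> stays in front, and for \<open>K\<close> after multiplication by
    \<open>x\<close>, when \<open>c\<close> is absorbed.\<close>
  then show ?case
    unfolding forest_vec_add_mset x_def[symmetric]
    using add.IH[OF add.prems] add.IH[OF lin, of x]
    by (simp add: dx S_add mult add.prems lin' der_add algebra_simps)
qed

lemma split_GL_der:
  assumes "linmap K"
  shows "split_GL K (der y p) = der y (split_GL K p) + split_GL (\<lambda>q. K (der y q) - der y (K q)) p"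
  by (rule linmap_ext[of "\<lambda>p. split_GL K (der y p)"
        "\<lambda>p. der y (split_GL K p) + split_GL (\<lambda>q. K (der y q) - der y (K q)) p"],
      (intro linmap_GL_intros linmap_split_GL)+, rule split_GL_der_forest[OF assms])

lemma linmap_graft_GL: "linmap f \<Longrightarrow> linmap (\<lambda>p. graft_GL t (f p))"
  unfolding graft_GL_def[abs_def] by (rule linmap_compose_lin)

text \<open>By \<open>graft_GL_mult\<close>, the term with \<open>y\<close> absorbed by
  \<open>K\<close> cancels the commutator term of \<open>split_GL_der\<close>. In terms of the
  product: left multiplication by \<open>s\<close> commutes with right multiplication by
  \<open>y\<close>.\<close>

lemma split_GL_graft_GL:
  fixes s :: "'d rtree" and p :: "('d, 'k::field) GL"
  defines "K \<equiv> \<lambda>q. T_to_GL (graft_GL s q)"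
  shows "split_GL K (p * T_to_GL y + der y p) = split_GL K p * T_to_GL y + der y (split_GL K p)"
proof -
  have K: "linmap K"
    unfolding K_def by (intro linmap_GL_intros linmap_graft_GL)
  have "K (T_to_GL y * q) = der y (K q) - K (der y q)" for q
    unfolding K_def by (simp add: mult.commute[of "T_to_GL y"] graft_GL_mult T_to_GL_diff der_T_to_GL)
  then have "split_GL (\<lambda>q. K (T_to_GL y * q)) p + split_GL (\<lambda>q. K (der y q) - der y (K q)) p = 0"
    by (simp add: split_GL_zero_fun flip: split_GL_add_fun)
  then have "split_GL (\<lambda>q. K (T_to_GL y * q)) p = - split_GL (\<lambda>q. K (der y q) - der y (K q)) p"
    by (simp add: eq_neg_iff_add_eq_0)
  then show ?thesis
    unfolding mult.commute[of _ "T_to_GL y"] linmap_add[OF linmap_split_GL[OF linmap_id]]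
      split_GL_mult[OF K] split_GL_der[OF K]
    by simp
qed

lemma GL_block_snoc:
  "GL_block (ys @ [y]) (g(length ys := i)) k = GL_block ys g k + (if i = k then {#y#} else {#})"
proof -
  have "map (\<lambda>j. if (g(length ys := i)) j = k then [(ys @ [y]) ! j] else []) [0..<length ys] =
      map (\<lambda>j. if g j = k then [ys ! j] else []) [0..<length ys]"
    by (rule map_cong) (auto simp: nth_append)
  then show ?thesis
    by (simp add: GL_block_def del: fun_upd_apply map_eq_conv) simp
qed

lemma sum_PiE_lessThan_Suc:
  "(\<Sum>f\<in>{..<Suc m} \<rightarrow>\<^sub>E B. h f) = (\<Sum>i\<in>B. \<Sum>g\<in>{..<m} \<rightarrow>\<^sub>E B. h (g(m := i)))"
proof -
  have "inj_on (\<lambda>(y, g). g(m := y)) (B \<times> ({..<m} \<rightarrow>\<^sub>E B))"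
    by (rule inj_combinator) simp
  then show ?thesis
    by (simp add: lessThan_Suc PiE_insert_eq sum.reindex sum.cartesian_product case_prod_unfold)
qed

text \<open>With a single tree on the left, a map to {0,1} is a splitting of the right forest: value
  0 keeps a tree in front, value 1 passes it to \<open>K\<close>.\<close>

lemma sum_GL_block:
  "(\<Sum>f\<in>{..<length ys} \<rightarrow>\<^sub>E {..1}. forest_vec (GL_block ys f 0) * K (GL_block ys f 1)) =
     split_sum (mset ys) K"
proof (induction ys arbitrary: K rule: rev_induct)
  case Nil
  then show ?case by (simp add: GL_block_def)
next
  case (snoc y ys)
  have "(\<Sum>f\<in>{..<length (ys @ [y])} \<rightarrow>\<^sub>E {..1}.
      forest_vec (GL_block (ys @ [y]) f 0) * K (GL_block (ys @ [y]) f 1)) =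
      (\<Sum>f\<in>{..<length ys} \<rightarrow>\<^sub>E {..1}.
        forest_vec {#y#} * (forest_vec (GL_block ys f 0) * K (GL_block ys f 1))) +
      (\<Sum>f\<in>{..<length ys} \<rightarrow>\<^sub>E {..1}.
        forest_vec (GL_block ys f 0) * K (add_mset y (GL_block ys f 1)))"
    by (simp add: sum_PiE_lessThan_Suc GL_block_snoc atMost_Suc forest_vec_mult add.commute
        del: fun_upd_apply flip: mult.assoc)
  then show ?case
    by (simp add: snoc.IH snoc.IH[of "\<lambda>G. K (add_mset y G)"] del: One_nat_def flip: sum_distrib_left)
qed

lemma some_mset_eq: "mset (SOME xs. mset xs = F) = F"
  by (rule someI_ex) (rule ex_mset)

lemma graft_forest_empty [simp]: "graft_forest t {#} = tree_vec t"
  using graft_forest_mset[of t "[]"] by simp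

lemma graft_forest_single [simp]: "graft_forest t {#y#} = graft_tree t y"
  using graft_forest_mset[of t "[y]"] by simp

lemma GL_forest_tree_left:
  "GL_forest {#s#} F = split_sum F (\<lambda>G. T_to_GL (graft_forest s G))"
  using sum_GL_block[of "SOME ys. mset ys = F" "\<lambda>G. T_to_GL (graft_forest s G)"]
  by (simp add: GL_forest_def GL_forest_list_def some_mset_eq forest_mult_eq forest_mult_list_def)

lemma GL_prod_tree_left:
  "forest_vec {#s#} \<star> p = split_GL (\<lambda>q. T_to_GL (graft_GL s q)) p"
  by (simp add: GL_prod_def split_GL_def GL_forest_tree_left[abs_def] graft_GL_def)

section \<open>Right multiplication by a tree and associativity\<close>

lemma der_prod:
  "der b (\<Prod>j<n. a j) = (\<Sum>i<n. \<Prod>j<n. if j = i then der b (a j) else a j)"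
  for n :: nat
proof (induction n)
  case (Suc n)
  have "(\<Prod>j<n. if j = n then der b (a j) else a j) = (\<Prod>j<n. a j)"
    by (rule prod.cong) auto
  moreover have "(\<Sum>i<n. (\<Prod>j<n. if j = i then der b (a j) else a j) * (if n = i then der b (a n) else a n))
    = (\<Sum>i<n. \<Prod>j<n. if j = i then der b (a j) else a j) * a n"
    unfolding sum_distrib_right by (rule sum.cong) auto
  ultimately show ?case
    by (simp add: der_mult Suc)
qed simp

lemma prod_forest_vec: "(\<Prod>j<length xs. forest_vec {#xs ! j#}) = (forest_vec (mset xs) :: ('d, 'k::field) GL)"
proof (induction xs rule: rev_induct)
  case Nil
  then show ?case by (simp)
next
  case (snoc x xs)
  have "(\<Prod>j<length xs. forest_vec {#(xs @ [x]) ! j#}) = (\<Prod>j<length xs. forest_vec {#xs ! j#} :: ('d, 'k) GL)"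
    by (rule prod.cong) (auto simp: nth_append)
  with snoc show ?case by (simp add: forest_vec_mult)
qed

lemma forest_mult_list_shift:
  "forest_mult_list (map (\<lambda>i. h (i - 1) i) [1..<n + 1]) = (\<Prod>j<n. h j (Suc j))"
proof -
  have "map (\<lambda>i. h (i - 1) i) [1..<n + 1] = map (\<lambda>j. h j (Suc j)) [0..<n]"
    by (rule nth_equalityI) (simp_all del: upt_Suc)
  moreover have "forest_mult_list ps = prod_list ps" for ps :: "('a, 'b) GL list"
    by (induction ps) (simp_all add: forest_mult_list_def forest_mult_eq)
  ultimately show ?thesis
    by (simp add: prod.list_conv_set_nth atLeast0LessThan)
qed

text \<open>Only \<open>y\<close> has to be placed. Value 0 gives the commutative product; the other
  values graft \<open>y\<close> onto one factor each, which are the Leibniz terms of the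
  derivation.\<close>

lemma GL_forest_tree_right:
  "GL_forest F {#y#} =
     (forest_vec F * forest_vec {#y#} + der (tree_vec y) (forest_vec F) :: ('d, 'k::field) GL)"
proof -
  define xs where "xs = (SOME xs. mset xs = F)"
  have xs: "mset xs = F" by (simp add: xs_def some_mset_eq)
  have block: "GL_block [y] (g(0 := i)) k = (if i = k then {#y#} else {#})" for g :: "nat \<Rightarrow> nat" and i k
    by (simp add: GL_block_def)
  \<comment> \<open>\<open>i\<close> is the value of the map at its only point; \<open>j\<close> and
    \<open>k = j + 1\<close> are the 0-based and 1-based positions of the same tree.\<close>
  define h where "h i j k = (T_to_GL (graft_forest (xs ! j) (if i = k then {#y#} else {#})) :: ('d, 'k) GL)"
    for i j k :: nat
  have "GL_forest F {#y#} = (GL_forest_list xs [y] :: ('d, 'k) GL)"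
    by (simp add: GL_forest_def xs_def)
  also have "\<dots> = (\<Sum>i\<le>length xs. forest_vec (if i = 0 then {#y#} else {#}) *
      forest_mult_list (map (\<lambda>k. h i (k - 1) k) [1..<length xs + 1]))"
    by (simp add: GL_forest_list_def sum_PiE_lessThan_Suc[where m = 0, simplified] block forest_mult_eq h_def
        del: upt_Suc fun_upd_apply)
  also have "\<dots> = (\<Sum>i\<le>length xs. forest_vec (if i = 0 then {#y#} else {#}) * (\<Prod>j<length xs. h i j (Suc j)))"
    by (simp only: forest_mult_list_shift)
  also have "\<dots> = forest_vec {#y#} * (\<Prod>j<length xs. h 0 j (Suc j)) +
      (\<Sum>i<length xs. \<Prod>j<length xs. h (Suc i) j (Suc j))"
    by (simp add: sum.atMost_shift)
  also have "(\<Prod>j<length xs. h 0 j (Suc j)) = forest_vec F"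
    by (simp add: h_def prod_forest_vec xs)
  also have "(\<Sum>i<length xs. \<Prod>j<length xs. h (Suc i) j (Suc j)) =
      (\<Sum>i<length xs. \<Prod>j<length xs.
        if j = i then der (tree_vec y) (forest_vec {#xs ! j#}) else forest_vec {#xs ! j#})"
    by (intro sum.cong prod.cong) (auto simp: h_def der_forest_vec)
  also have "\<dots> = der (tree_vec y) (forest_vec F)"
    by (simp add: prod_forest_vec xs flip: der_prod)
  finally show ?thesis by (simp add: mult.commute)
qed

lemma linmap_GL_prod_left: "linmap f \<Longrightarrow> linmap (\<lambda>p. f p \<star> q)"
  unfolding GL_prod_def[abs_def] by (intro linmap_intros)

lemma linmap_GL_prod_right: "linmap f \<Longrightarrow> linmap (\<lambda>q. p \<star> f q)"
  unfolding GL_prod_def[abs_def] by (intro linmap_intros)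

lemma GL_prod_T_to_GL_right: "p \<star> T_to_GL y = p * T_to_GL y + der y p"
proof -
  have "p \<star> forest_vec {#y#} = p * forest_vec {#y#} + der (tree_vec y) p" for y
    by (rule linmap_ext[of "\<lambda>p. p \<star> forest_vec {#y#}" "\<lambda>p. p * forest_vec {#y#} + der (tree_vec y) p"],
        (intro linmap_GL_intros linmap_GL_prod_left)+, simp add: GL_prod_def GL_forest_tree_right)
  then show ?thesis
    by - (rule linmap_ext[of "\<lambda>y. p \<star> T_to_GL y" "\<lambda>y. p * T_to_GL y + der y p"],
        (intro linmap_GL_intros linmap_GL_prod_right)+, simp)
qed

text \<open>With left multiplication written as \<open>split_GL\<close> and right multiplication
  through \<open>der\<close>, this is \<open>split_GL_graft_GL\<close>, extended linearly in
  \<open>s\<close>.\<close>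

lemma GL_prod_assoc_tree: "(T_to_GL s \<star> p) \<star> T_to_GL y = T_to_GL s \<star> (p \<star> T_to_GL y)"
proof -
  have "(forest_vec {#s#} \<star> p) \<star> T_to_GL y = forest_vec {#s#} \<star> (p \<star> T_to_GL y)" for s
    unfolding GL_prod_T_to_GL_right GL_prod_tree_left by (rule split_GL_graft_GL[symmetric])
  then show ?thesis
    by - (rule linmap_ext[of "\<lambda>s. (T_to_GL s \<star> p) \<star> T_to_GL y" "\<lambda>s. T_to_GL s \<star> (p \<star> T_to_GL y)"],
        (intro linmap_GL_intros linmap_GL_prod_left)+, simp)
qed

lemma GL_prod_forest_unit: "T_to_GL s \<star> forest_vec {#} = T_to_GL s"
  by (rule linmap_ext[of "\<lambda>s. T_to_GL s \<star> forest_vec {#}" T_to_GL],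
      (intro linmap_GL_intros linmap_GL_prod_left)+)
     (simp add: GL_prod_def GL_forest_tree_left)

subsection \<open>Sums over subsets and ordered partitions\<close>

text \<open>Summing over enumerations of \<open>I\<close> rather than permutations of positions
  makes removal of an index easy; \<open>x\<close> is arbitrary because the recursion alters
  it.\<close>

definition graft_perms :: "('i \<Rightarrow> 'd rtree) \<Rightarrow> 'i set \<Rightarrow> ('d, 'k::field) TT \<Rightarrow> ('d, 'k) TT" where
  "graft_perms t I x = (\<Sum>as\<in>permutations_of_set I. foldr (\<lambda>a. graft (tree_vec (t a))) as x)"

lemma graft_perms_empty [simp]: "graft_perms t {} x = x"
  by (simp add: graft_perms_def)

text \<open>The orders are classified by their last index \<open>a\<close>, whose tree is the first
  to receive \<open>x\<close>.\<close>

lemma graft_perms_last: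
  assumes "finite I" "I \<noteq> {}"
  shows "graft_perms t I x = (\<Sum>a\<in>I. graft_perms t (I - {a}) (graft (tree_vec (t a)) x))"
proof -
  have snoc: "\<exists>as a. xs = as @ [a] \<and> a \<in> I \<and> as \<in> permutations_of_set (I - {a})"
    if "xs \<in> permutations_of_set I" for xs
    using that assms by (cases xs rule: rev_cases) (auto simp: permutations_of_set_def)
  have "graft_perms t I x = (\<Sum>(a, as)\<in>(SIGMA a:I. permutations_of_set (I - {a})).
      foldr (\<lambda>a. graft (tree_vec (t a))) as (graft (tree_vec (t a)) x))"
    unfolding graft_perms_def
  proof (rule sum.reindex_bij_witness[where i = "\<lambda>(a, as). as @ [a]" and j = "\<lambda>xs. (last xs, butlast xs)"])
    fix xs assume "xs \<in> permutations_of_set I"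
    then obtain as a where "xs = as @ [a]" "a \<in> I" "as \<in> permutations_of_set (I - {a})"
      using snoc by blast
    then show "(case (last xs, butlast xs) of (a, as) \<Rightarrow> as @ [a]) = xs"
      "(last xs, butlast xs) \<in> (SIGMA a:I. permutations_of_set (I - {a}))"
      "(case (last xs, butlast xs) of (a, as) \<Rightarrow>
          foldr (\<lambda>a. graft (tree_vec (t a))) as (graft (tree_vec (t a)) x)) =
        foldr (\<lambda>a. graft (tree_vec (t a))) xs x"
      by simp_all
  next
    fix p assume "p \<in> (SIGMA a:I. permutations_of_set (I - {a}))"
    then obtain a as where p: "p = (a, as)" "a \<in> I" "set as = I - {a}" "distinct as"
      by (auto simp: permutations_of_set_def)
    have "a \<notin> set as" "insert a (set as) = I"
      unfolding p(3) using p(2) by (simp_all add: insert_absorb)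
    with p(1,4) show "(case p of (a, as) \<Rightarrow> as @ [a]) \<in> permutations_of_set I"
      by (simp add: permutations_of_set_def)
    show "(last (case p of (a, as) \<Rightarrow> as @ [a]), butlast (case p of (a, as) \<Rightarrow> as @ [a])) = p"
      by (simp add: p)
  qed
  then show ?thesis
    using assms by (simp add: graft_perms_def sum.Sigma)
qed

text \<open>Factors are addressed by indices, so equal trees at different indices stay
  distinguishable.\<close>

definition monomial_of :: "('i \<Rightarrow> 'd rtree) \<Rightarrow> 'i set \<Rightarrow> ('d, 'k::field) GL" where
  "monomial_of t A = forest_vec (image_mset t (mset_set A))"

lemma monomial_of_insert:
  "finite A \<Longrightarrow> a \<notin> A \<Longrightarrow> monomial_of t (insert a A) = monomial_of t A * T_to_GL (tree_vec (t a))"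
  by (simp add: monomial_of_def forest_vec_mult)

lemma der_monomial_of:
  assumes "finite A"
  shows "der x (monomial_of t A) =
    (\<Sum>a\<in>A. monomial_of t (A - {a}) * T_to_GL (graft (tree_vec (t a)) x))"
proof -
  have "der x (monomial_of t A) = (\<Sum>a\<in>A. forest_vec (image_mset t (mset_set A) - {#t a#}) *
      T_to_GL (graft (tree_vec (t a)) x))"
    by (simp add: monomial_of_def der_forest_vec sum_unfold_sum_mset image_mset.compositionality o_def)
  also have "\<dots> = (\<Sum>a\<in>A. monomial_of t (A - {a}) * T_to_GL (graft (tree_vec (t a)) x))"
    using assms by (intro sum.cong) (auto simp: monomial_of_def mset_set.remove)
  finally show ?thesis .
qed

lemma monomial_of_mult:
  fixes x :: "('d, 'k::field) TT"
  assumes "finite A"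
  shows "monomial_of t A * T_to_GL x =
    (\<Sum>I\<in>Pow A. smult ((- 1) ^ card I) (monomial_of t (A - I) \<star> T_to_GL (graft_perms t I x)))"
  using assms
proof (induction A arbitrary: x rule: finite_psubset_induct)
  case (psubset A)
  define h where "h I y = monomial_of t (A - I) \<star> T_to_GL y" for I and y :: "('d, 'k) TT"
  have lin_h: "linmap (h I)" for I
    unfolding h_def[abs_def] by (intro linmap_GL_prod_right linmap_T_to_GL)
  have absorb: "J - {a} = J" if "J \<subseteq> A - {a}" for a J
    using that by blast
  have fin: "finite I" if "I \<subseteq> A" for I
    using that psubset.hyps by (rule finite_subset)
  \<comment> \<open>The induction hypothesis for \<open>A - {a}\<close> is taken at the altered
    argument \<open>graft (tree_vec (t a)) x\<close>; passing from \<open>J\<close> to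
    \<open>insert a J\<close> changes the sign.\<close>
  have "monomial_of t (A - {a}) * T_to_GL (graft (tree_vec (t a)) x) =
      (\<Sum>J\<in>Pow (A - {a}). - smult ((- 1) ^ card (insert a J))
         (h (insert a J) (graft_perms t J (graft (tree_vec (t a)) x))))"
    if "a \<in> A" for a
  proof -
    have "A - {a} \<subset> A" using that by auto
    note psubset.IH[OF this]
    moreover have "smult ((- 1) ^ card J) (monomial_of t (A - {a} - J) \<star> T_to_GL y) =
        - smult ((- 1) ^ card (insert a J)) (h (insert a J) y)"
      if "J \<in> Pow (A - {a})" for J y
    proof -
      have "a \<notin> J" "finite J" using that fin[of J] by auto
      moreover have "A - {a} - J = A - insert a J" by auto
      ultimately show ?thesis by (simp add: h_def smult_minus_left)
    qed
    ultimately show ?thesis by simp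
  qed
  then have "der x (monomial_of t A) = (\<Sum>a\<in>A. \<Sum>J\<in>Pow (A - {a}). - smult ((- 1) ^ card (insert a J))
         (h (insert a J) (graft_perms t J (graft (tree_vec (t a)) x))))"
    using psubset.hyps by (simp add: der_monomial_of)
  also have "\<dots> = - (\<Sum>(a, J)\<in>(SIGMA a:A. Pow (A - {a})). smult ((- 1) ^ card (insert a J))
         (h (insert a J) (graft_perms t J (graft (tree_vec (t a)) x))))"
    using psubset.hyps by (simp add: sum.Sigma sum_negf)
  \<comment> \<open>Pairs of \<open>a\<close> and \<open>J\<close> avoiding \<open>a\<close> are
    regrouped as a nonempty \<open>I = insert a J\<close> with a marked element; summing over the
    mark gives \<open>graft_perms\<close> on \<open>I\<close>.\<close>
  also have "\<dots> = - (\<Sum>(I, a)\<in>(SIGMA I:Pow A - {{}}. I). smult ((- 1) ^ card I)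
         (h I (graft_perms t (I - {a}) (graft (tree_vec (t a)) x))))"
    by (rule arg_cong[where f = uminus],
        rule sum.reindex_bij_witness[where i = "\<lambda>(I, a). (a, I - {a})" and j = "\<lambda>(a, J). (insert a J, a)"])
       (auto simp: insert_absorb absorb)
  also have "\<dots> = - (\<Sum>I\<in>Pow A - {{}}. \<Sum>a\<in>I. smult ((- 1) ^ card I)
         (h I (graft_perms t (I - {a}) (graft (tree_vec (t a)) x))))"
    using psubset.hyps fin by (subst sum.Sigma) auto
  also have "\<dots> = - (\<Sum>I\<in>Pow A - {{}}. smult ((- 1) ^ card I) (h I (graft_perms t I x)))"
    using fin
    by (intro arg_cong[where f = uminus] sum.cong refl)
       (simp add: graft_perms_last linmap_sum[OF lin_h] linmap_sum[OF linmap_scale])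
  finally have "h {} x = monomial_of t A * T_to_GL x -
      (\<Sum>I\<in>Pow A - {{}}. smult ((- 1) ^ card I) (h I (graft_perms t I x)))"
    by (simp add: h_def GL_prod_T_to_GL_right)
  moreover have "(\<Sum>I\<in>Pow A. smult ((- 1) ^ card I) (h I (graft_perms t I x))) =
      h {} x + (\<Sum>I\<in>Pow A - {{}}. smult ((- 1) ^ card I) (h I (graft_perms t I x)))"
    using psubset.hyps by (subst sum.remove[of "Pow A" "{}"]) auto
  ultimately show ?case
    by (simp add: h_def)
qed

section \<open>Comparison with the block elements \<open>t_block\<close>\<close>

lemma bij_betw_permute_list:
  assumes "distinct qs"
  shows "bij_betw (\<lambda>\<sigma>. permute_list \<sigma> qs) {\<sigma>. \<sigma> permutes {..<length qs}} (permutations_of_set (set qs))"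
  unfolding bij_betw_def
proof
  show "inj_on (\<lambda>\<sigma>. permute_list \<sigma> qs) {\<sigma>. \<sigma> permutes {..<length qs}}"
  proof (rule inj_onI, rule ext)
    fix \<sigma> \<tau> j
    assume perm: "\<sigma> \<in> {\<sigma>. \<sigma> permutes {..<length qs}}" "\<tau> \<in> {\<sigma>. \<sigma> permutes {..<length qs}}"
      and eq: "permute_list \<sigma> qs = permute_list \<tau> qs"
    show "\<sigma> j = \<tau> j"
    proof (cases "j < length qs")
      case True
      then have "\<sigma> j < length qs" "\<tau> j < length qs"
        using perm permutes_in_image by (metis lessThan_iff mem_Collect_eq)+
      moreover have "qs ! \<sigma> j = qs ! \<tau> j"
        using True perm eq by (metis mem_Collect_eq permute_list_nth)
      ultimately show ?thesis
        using assms by (simp add: nth_eq_iff_index_eq)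
    next
      case False
      with perm show ?thesis by (simp add: permutes_not_in)
    qed
  qed
  show "(\<lambda>\<sigma>. permute_list \<sigma> qs) ` {\<sigma>. \<sigma> permutes {..<length qs}} = permutations_of_set (set qs)"
  proof (intro equalityI subsetI)
    fix xs assume "xs \<in> permutations_of_set (set qs)"
    then have "mset xs = mset qs"
      using assms set_eq_iff_mset_eq_distinct by (auto simp: permutations_of_set_def)
    then show "xs \<in> (\<lambda>\<sigma>. permute_list \<sigma> qs) ` {\<sigma>. \<sigma> permutes {..<length qs}}"
      by (rule mset_eq_permutation) auto
  qed (use assms in \<open>auto simp: permutations_of_set_def\<close>)
qed

text \<open>The largest index stays innermost, so the permutations of the other positions run
  through all orders of \<open>I\<close>.\<close>

lemma t_block_insert_Max:
  assumes "finite I" "\<And>i. i \<in> I \<Longrightarrow> i < m"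
  shows "t_block t (insert m I) = graft_perms t I (tree_vec (t m))"
proof -
  define qs where "qs = sorted_list_of_set I"
  have qs: "set qs = I" "distinct qs" "sorted qs"
    using assms by (simp_all add: qs_def)
  have "set (sorted_list_of_set (insert m I)) = set (qs @ [m])"
    using qs(1) assms(1) by (simp del: sorted_list_of_set_insert_remove)
  then have "sorted_list_of_set (insert m I) = qs @ [m]"
    using qs assms(2)
    by (intro sorted_distinct_set_unique) (auto simp: sorted_append less_imp_le)
  then have "t_block t (insert m I) = (\<Sum>\<sigma> | \<sigma> permutes {..<length qs}.
      nested_graft (map (\<lambda>j. t ((qs @ [m]) ! \<sigma> j)) [0..<length qs]) (t m))"
    by (simp add: t_block_def)
  also have "\<dots> = (\<Sum>\<sigma> | \<sigma> permutes {..<length qs}. nested_graft (map t (permute_list \<sigma> qs)) (t m))"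
  proof (intro sum.cong refl arg_cong[where f = "\<lambda>as. nested_graft as (t m)"])
    fix \<sigma> assume "\<sigma> \<in> {\<sigma>. \<sigma> permutes {..<length qs}}"
    then have "\<sigma> j < length qs" if "j < length qs" for j
      using that permutes_in_image by (metis lessThan_iff mem_Collect_eq)
    then show "map (\<lambda>j. t ((qs @ [m]) ! \<sigma> j)) [0..<length qs] = map t (permute_list \<sigma> qs)"
      by (simp add: permute_list_def nth_append)
  qed
  also have "\<dots> = (\<Sum>as\<in>permutations_of_set I. nested_graft (map t as) (t m))"
    using sum.reindex_bij_betw[OF bij_betw_permute_list[OF qs(2)]] qs(1) by fast
  also have "\<dots> = graft_perms t I (tree_vec (t m))"
    by (simp add: graft_perms_def nested_graft_def foldr_map o_def)
  finally show ?thesis .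
qed

text \<open>Blocks are nonempty and disjoint, so for finite \<open>A\<close> their maxima differ and
  each set partition occurs as exactly one list.\<close>

definition ordered_partitions :: "'a::linorder set \<Rightarrow> 'a set list set" where
  "ordered_partitions A = {Ps. partition_on A (set Ps) \<and> sorted_wrt (\<lambda>P Q. Max P < Max Q) Ps}"

lemma ordered_partitions_empty [simp]: "ordered_partitions {} = {[]}"
  by (auto simp: ordered_partitions_def partition_on_empty)

text \<open>The maxima are distinct elements of \<open>A\<close>. The bound yields finiteness and
  keeps the subtraction in the sign exponent from truncating.\<close>

lemma length_ordered_partition:
  assumes "finite A" "Ps \<in> ordered_partitions A"
  shows "length Ps \<le> card A"
proof -
  have "sorted_wrt (<) (map Max Ps)"
    using assms(2) by (simp add: ordered_partitions_def sorted_wrt_map)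
  then have "distinct (map Max Ps)" by (simp add: strict_sorted_iff)
  moreover have "set (map Max Ps) \<subseteq> A"
  proof -
    have "Max P \<in> A" if "P \<in> set Ps" for P
    proof -
      have "P \<subseteq> A" "P \<noteq> {}"
        using assms(2) that by (auto simp: ordered_partitions_def partition_on_def)
      then show ?thesis using Max_in assms(1) by (meson finite_subset subsetD)
    qed
    then show ?thesis by auto
  qed
  ultimately show ?thesis
    using assms(1) by (metis card_mono distinct_card length_map)
qed

lemma finite_ordered_partitions:
  assumes "finite A"
  shows "finite (ordered_partitions A)"
proof (rule finite_subset)
  show "ordered_partitions A \<subseteq> {Ps. set Ps \<subseteq> Pow A \<and> length Ps \<le> card A}"
    using length_ordered_partition[OF assms]
    by (auto simp: ordered_partitions_def partition_on_def)
qed (use assms in \<open>simp add: finite_lists_length_le\<close>)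

lemma ordered_partitions_snoc:
  assumes "finite A" "\<And>a. a \<in> A \<Longrightarrow> a < m" "I \<subseteq> A" "Qs \<in> ordered_partitions (A - I)"
  shows "Qs @ [insert m I] \<in> ordered_partitions (insert m A)"
proof -
  have part: "partition_on (A - I) (set Qs)"
    using assms(4) by (simp add: ordered_partitions_def)
  have "Max Q < Max (insert m I)" if "Q \<in> set Qs" for Q
  proof -
    have "Q \<subseteq> A" "Q \<noteq> {}" using part that by (auto simp: partition_on_def)
    then have "Max Q < m" using assms(1,2) by (meson Max_in finite_subset subsetD)
    also have "m \<le> Max (insert m I)" using assms(1,3) by (meson Max_ge finite_insert finite_subset insertI1)
    finally show ?thesis .
  qed
  moreover have "partition_on (insert m A) (insert (insert m I) (set Qs))"
  proof -
    have "insert m A - insert m I = A - I" using assms(2,3) by auto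
    moreover have "disjnt (insert m I) (\<Union>(set Qs))"
      using assms(2) by (auto simp: disjnt_iff simp flip: partition_onD1[OF part])
    ultimately show ?thesis
      using part assms(3) by (auto simp: partition_on_insert)
  qed
  ultimately show ?thesis
    using assms(4) by (simp add: ordered_partitions_def sorted_wrt_append)
qed

lemma ordered_partitions_snocE:
  assumes "finite A" "\<And>a. a \<in> A \<Longrightarrow> a < m" "Ps \<in> ordered_partitions (insert m A)"
  obtains Qs I where "Ps = Qs @ [insert m I]" "m \<notin> I" "I \<subseteq> A" "Qs \<in> ordered_partitions (A - I)"
proof -
  have part: "partition_on (insert m A) (set Ps)" and sorted: "sorted_wrt (\<lambda>P Q. Max P < Max Q) Ps"
    using assms(3) by (simp_all add: ordered_partitions_def)
  from part have "Ps \<noteq> []" by (auto simp: partition_on_def)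
  then obtain Qs P where Ps: "Ps = Qs @ [P]" by (metis rev_exhaust)
  have less: "Max Q < Max P" if "Q \<in> set Qs" for Q
    using sorted that by (simp add: Ps sorted_wrt_append)
  have sub: "Q \<subseteq> insert m A" "finite Q" "Q \<noteq> {}" if "Q \<in> set Ps" for Q
    using part that assms(1) by (auto simp: partition_on_def intro: finite_subset)
  have "Max P \<le> m"
    using sub[of P] assms(2) by (auto simp: Ps less_imp_le)
  \<comment> \<open>Otherwise \<open>m\<close> would lie in an earlier block, whose maximum would be
    at least that of the last block.\<close>
  have "m \<in> P"
  proof (rule ccontr)
    assume "m \<notin> P"
    then obtain Q where Q: "Q \<in> set Qs" "m \<in> Q"
      using part by (auto simp: Ps partition_on_def)
    then have "m \<le> Max Q" using sub[of Q] by (simp add: Ps)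
    with less[OF Q(1)] \<open>Max P \<le> m\<close> show False by simp
  qed
  show ?thesis
  proof (rule that[of Qs "P - {m}"])
    show "P - {m} \<subseteq> A" using sub[of P] by (auto simp: Ps)
    \<comment> \<open>The set of blocks forgets repetitions; that \<open>P\<close> does not recur
      comes from the strict order of the maxima.\<close>
    have "P \<notin> set Qs" using less by blast
    moreover have "disjoint (insert P (set Qs))"
      using partition_onD2[OF part] by (simp add: Ps)
    ultimately have "disjnt P (\<Union>(set Qs))"
      by (auto simp: pairwise_insert)
    then have "partition_on (insert m A - P) (set Qs)"
      using part by (simp add: Ps partition_on_insert)
    moreover have "insert m A - P = A - (P - {m})"
      using \<open>m \<in> P\<close> assms(2) by auto
    ultimately have "partition_on (A - (P - {m})) (set Qs)" by simp
    then show "Qs \<in> ordered_partitions (A - (P - {m}))"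
      using sorted by (simp add: ordered_partitions_def Ps sorted_wrt_append)
  qed (use \<open>m \<in> P\<close> Ps in auto)
qed

lemma sum_ordered_partitions:
  assumes "finite A" "\<And>a. a \<in> A \<Longrightarrow> a < m"
  shows "(\<Sum>Ps\<in>ordered_partitions (insert m A). h Ps) =
    (\<Sum>I\<in>Pow A. \<Sum>Qs\<in>ordered_partitions (A - I). h (Qs @ [insert m I]))"
proof -
  have m: "m \<notin> A" using assms(2) by blast
  have "(\<Sum>Ps\<in>ordered_partitions (insert m A). h Ps) =
      (\<Sum>(I, Qs)\<in>(SIGMA I:Pow A. ordered_partitions (A - I)). h (Qs @ [insert m I]))"
  proof (rule sum.reindex_bij_witness[where i = "\<lambda>(I, Qs). Qs @ [insert m I]"
        and j = "\<lambda>Ps. (last Ps - {m}, butlast Ps)"])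
    fix Ps assume "Ps \<in> ordered_partitions (insert m A)"
    then obtain Qs I where Ps: "Ps = Qs @ [insert m I]" "m \<notin> I" "I \<subseteq> A" "Qs \<in> ordered_partitions (A - I)"
      using ordered_partitions_snocE[OF assms] by metis
    then show "(case (last Ps - {m}, butlast Ps) of (I, Qs) \<Rightarrow> Qs @ [insert m I]) = Ps"
      "(last Ps - {m}, butlast Ps) \<in> (SIGMA I:Pow A. ordered_partitions (A - I))"
      "(case (last Ps - {m}, butlast Ps) of (I, Qs) \<Rightarrow> h (Qs @ [insert m I])) = h Ps"
      by simp_all
  qed (use m ordered_partitions_snoc[OF assms] in auto)
  then show ?thesis
    using assms(1) by (simp add: sum.Sigma finite_ordered_partitions)
qed

text \<open>\<open>GL_prod_list\<close> nests to the right, so appending a factor needs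
  associativity. The induction removes factors on the left, so both outer factors are always
  combinations of trees.\<close>

lemma GL_prod_list_snoc:
  "GL_prod_list (map T_to_GL ps) \<star> T_to_GL y = GL_prod_list (map T_to_GL (ps @ [y]))"
proof (induction ps)
  case Nil
  show ?case
    by (simp add: GL_prod_list_def GL_prod_T_to_GL_right GL_prod_forest_unit[simplified])
next
  case (Cons p ps)
  then show ?case
    by (simp add: GL_prod_list_def GL_prod_assoc_tree)
qed

section \<open>The expansion over ordered partitions\<close>

lemma monomial_of_eq_sum_ordered_partitions:
  assumes "finite A"
  shows "(monomial_of t A :: ('d, 'k::field) GL) =
    (\<Sum>Ps\<in>ordered_partitions A.
       smult ((- 1) ^ (card A - length Ps)) (GL_prod_list (map (\<lambda>P. T_to_GL (t_block t P)) Ps)))"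
  using assms
proof (induction A rule: finite_psubset_induct)
  case (psubset A)
  show ?case
  proof (cases "A = {}")
    case True
    then show ?thesis by (simp add: monomial_of_def GL_prod_list_def)
  next
    case False
    define m B where "m = Max A" and "B = A - {m}"
    have "m \<in> A" using psubset.hyps False by (simp add: m_def)
    then have A: "A = insert m B" "finite B" "m \<notin> B" and less: "\<And>b. b \<in> B \<Longrightarrow> b < m"
      using psubset.hyps Max_ge[of A] by (auto simp: B_def m_def less_le)
    define G where "G Ps = (GL_prod_list (map (\<lambda>P. T_to_GL (t_block t P)) Ps) :: ('d, 'k) GL)" for Ps
    have snoc: "G Qs \<star> T_to_GL (t_block t P) = G (Qs @ [P])" for Qs P
      using GL_prod_list_snoc[of "map (t_block t) Qs" "t_block t P"] by (simp add: G_def o_def)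
    have "smult ((- 1) ^ card I) (monomial_of t (B - I) \<star> T_to_GL (graft_perms t I (tree_vec (t m)))) =
        (\<Sum>Qs\<in>ordered_partitions (B - I). smult ((- 1) ^ (card A - length (Qs @ [insert m I]))) (G (Qs @ [insert m I])))"
      if "I \<subseteq> B" for I
    proof -
      have fin: "finite I" using that A(2) by (rule finite_subset)
      have "monomial_of t (B - I) = (\<Sum>Qs\<in>ordered_partitions (B - I). smult ((- 1) ^ (card (B - I) - length Qs)) (G Qs))"
        unfolding G_def by (rule psubset.IH) (use A in auto)
      moreover have "graft_perms t I (tree_vec (t m)) = (t_block t (insert m I) :: ('d, 'k) TT)"
        using fin less that by (subst t_block_insert_Max) auto
      ultimately have "smult ((- 1) ^ card I) (monomial_of t (B - I) \<star> T_to_GL (graft_perms t I (tree_vec (t m)))) =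
          (\<Sum>Qs\<in>ordered_partitions (B - I).
             smult ((- 1) ^ (card I + (card (B - I) - length Qs))) (G (Qs @ [insert m I])))"
        by (simp add: linmap_sum[OF linmap_GL_prod_left[OF linmap_id]] linmap_smult[OF linmap_GL_prod_left[OF linmap_id]]
            linmap_sum[OF linmap_scale] smult_smult snoc power_add)
      \<comment> \<open>The additional block is matched by the element \<open>m\<close>, since
        \<open>card A = card B + 1\<close>; the length bound makes the natural-number subtractions
        exact.\<close>
      moreover have "card I + (card (B - I) - length Qs) = card A - length (Qs @ [insert m I])"
        if "Qs \<in> ordered_partitions (B - I)" for Qs
        using length_ordered_partition[OF _ that] A fin \<open>I \<subseteq> B\<close> card_mono[OF A(2) \<open>I \<subseteq> B\<close>]
        by (simp add: card_Diff_subset)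
      ultimately show ?thesis by simp
    qed
    then have "monomial_of t A = (\<Sum>I\<in>Pow B. \<Sum>Qs\<in>ordered_partitions (B - I).
        smult ((- 1) ^ (card A - length (Qs @ [insert m I]))) (G (Qs @ [insert m I])))"
      unfolding A(1) monomial_of_insert[OF A(2,3)] monomial_of_mult[OF A(2)]
      by (intro sum.cong) auto
    also have "\<dots> = (\<Sum>Ps\<in>ordered_partitions A. smult ((- 1) ^ (card A - length Ps)) (G Ps))"
      using sum_ordered_partitions[OF A(2) less, of "\<lambda>Ps. smult ((- 1) ^ (card A - length Ps)) (G Ps)"]
      by (simp add: A(1)[symmetric])
    finally show ?thesis by (simp add: G_def)
  qed
qed

theorem theorem1p2:
  fixes t :: "nat \<Rightarrow> 'd rtree" and n :: nat
  assumes "n \<ge> 1"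
  shows "(forest_vec (mset (map t [1..<n + 1])) :: ('d, 'k::field_char_0) GL) =
    (\<Sum>Ps \<in> {Ps. partition_on {1..n} (set Ps) \<and> sorted_wrt (\<lambda>A B. Max A < Max B) Ps}.
       smult ((-1) ^ (n - length Ps))
         (GL_prod_list (map (\<lambda>P. T_to_GL (t_block t P)) Ps)))"
proof -
  have "mset (map t [1..<n + 1]) = image_mset t (mset_set {1..n})"
    by (simp add: atLeastLessThanSuc_atLeastAtMost del: upt_Suc)
  then show ?thesis
    using monomial_of_eq_sum_ordered_partitions[of "{1..n}" t]
    by (simp add: monomial_of_def ordered_partitions_def)
qed

end
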